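(* Let $f_n$ be a polynomial in $n$ such that $f_n\ge1$ for all $n\ge1$, and let $m$ be a positive integer. (i) If $f_2>2$ then $$K_{n=1}^{\infty}\frac{f_n((n^2-1)nm+1)+2mn(n+1)-1}{f_n((n^2-3n+2)mn+1)+2mn(n-2)-2}=1 .$$ (ii) $$K_{n=1}^{\infty}\frac{f_n((n^2+3n+2)nm+1)+2mn^2+6mn+4m-1}{f_n((n^2-1)nm+1)+2(n^2-1)m-2}=6m+1 .$$
   Context: For sequences $\{a_n\}_{n\ge1}$, $\{b_n\}_{n\ge1}$, $K_{n=1}^{N}\frac{a_n}{b_n}$ denotes the finite continued fraction $\cfrac{a_1}{b_1+\cfrac{a_2}{b_2+\cdots+\cfrac{a_N}{b_N}}}$, written as $A_N/B_N$, where $A_{-1}=1$, $A_0=0$, $B_{-1}=0$, $B_0=1$, and $A_n=b_nA_{n-1}+a_nA_{n-2}$, $B_n=b_nB_{n-1}+a_nB_{n-2}$ for $n\ge1$. $K_{n=1}^{\infty}\frac{a_n}{b_n}$ denotes $\lim_{N\to\infty}A_N/B_N$; a stated value means that $B_N\neq0$ for all large $N$ and that the limit exists and has that value. Polynomials $f_n$ have real coefficients. *)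

theory Defs
  imports "HOL-Analysis.Analysis" "HOL-Computational_Algebra.Polynomial"
begin

text \<open>
  Numerators \<open>A\<^sub>N\<close> and denominators \<open>B\<^sub>N\<close> of the continued fraction with partial numerators
  \<open>a n\<close> and partial denominators \<open>b n\<close> for \<open>n \<ge> 1\<close>; \<open>a 0\<close> and \<open>b 0\<close> are never used.
  As the index is a natural number, the initial values \<open>A\<^sub>-\<^sub>1 = 1\<close> and \<open>B\<^sub>-\<^sub>1 = 0\<close> are
  substituted into the instance \<open>n = 1\<close> of the three-term recurrence.
\<close>

fun cf_num :: "(nat \<Rightarrow> real) \<Rightarrow> (nat \<Rightarrow> real) \<Rightarrow> nat \<Rightarrow> real" where
  "cf_num a b 0 = 0"
| "cf_num a b (Suc 0) = b 1 * 0 + a 1 * 1"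
| "cf_num a b (Suc (Suc n)) =
     b (Suc (Suc n)) * cf_num a b (Suc n) + a (Suc (Suc n)) * cf_num a b n"

fun cf_den :: "(nat \<Rightarrow> real) \<Rightarrow> (nat \<Rightarrow> real) \<Rightarrow> nat \<Rightarrow> real" where
  "cf_den a b 0 = 1"
| "cf_den a b (Suc 0) = b 1 * 1 + a 1 * 0"
| "cf_den a b (Suc (Suc n)) =
     b (Suc (Suc n)) * cf_den a b (Suc n) + a (Suc (Suc n)) * cf_den a b n"

text \<open>
  The nonvanishing condition is not redundant: division by zero yields \<open>0\<close> here, so the
  limit alone would not ensure that the convergents are eventually well defined.
\<close>

definition has_cf_value :: "(nat \<Rightarrow> real) \<Rightarrow> (nat \<Rightarrow> real) \<Rightarrow> real \<Rightarrow> bool" where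
  "has_cf_value a b L \<longleftrightarrow>
     (\<forall>\<^sub>F N in sequentially. cf_den a b N \<noteq> 0) \<and>
     (\<lambda>N. cf_num a b N / cf_den a b N) \<longlonglongrightarrow> L"

end

theory Submission
  imports Defs "HOL-Real_Asymp.Real_Asymp"
begin

text \<open>
  Let \<open>g x = (x\<^sup>3 - x) m + 1\<close>. In both parts the terms of the partial quotients that involve \<open>f\<close>
  cancel from the combination \<open>a\<^sub>n h\<^sub>n\<^sub>-\<^sub>2 - b\<^sub>n h\<^sub>n\<^sub>-\<^sub>1\<close>, where \<open>h\<^sub>n = g (n + 1)\<close> in (i) and
  \<open>h\<^sub>n = g (n + 2)\<close> in (ii), and what remains is \<open>h\<^sub>n\<close>. Hence \<open>A\<^sub>n - h\<^sub>0 B\<^sub>n = (-1)\<^sup>n\<^sup>+\<^sup>1 h\<^sub>n\<close>. The ratios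
  \<open>c\<^sub>n = B\<^sub>n / h\<^sub>n\<close> satisfy \<open>c\<^sub>n = p\<^sub>n c\<^sub>n\<^sub>-\<^sub>1 + (1 + p\<^sub>n) c\<^sub>n\<^sub>-\<^sub>2\<close> with \<open>p\<^sub>n = b\<^sub>n h\<^sub>n\<^sub>-\<^sub>1 / h\<^sub>n\<close>, so once
  \<open>p\<^sub>n \<ge> 1\<close> and two consecutive \<open>B\<^sub>n\<close> are positive they tend to infinity, and the value is \<open>h\<^sub>0\<close>.
  The early denominators need separate care, as \<open>B\<^sub>1\<close> can be zero or negative.
\<close>

section \<open>A convergence criterion from an alternating solution of the recurrence\<close>

text \<open>The growth bound speaks only of nonnegative pairs, so the induction also keeps both
  terms above \<open>d\<close>; each step then adds at least \<open>2 * d\<close>, more than the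
  \<open>d / 2\<close> claimed.\<close>

lemma filterlim_at_top_of_linear_growth:
  fixes c :: "nat \<Rightarrow> real"
  assumes pos: "c 2 > 0" "c 3 > 0"
    and growth: "\<And>n. n \<ge> 2 \<Longrightarrow> c n \<ge> 0 \<Longrightarrow> c (Suc n) \<ge> 0 \<Longrightarrow> c (Suc (Suc n)) \<ge> c (Suc n) + 2 * c n"
  shows "filterlim c at_top sequentially"
proof -
  define d where "d = min (c 2) (c 3)"
  have d: "d > 0" "d \<le> c 2" "d \<le> c 3"
    using pos by (auto simp: d_def)
  have bound: "c (k + 2) \<ge> d * (real k + 1) / 2 \<and> c (k + 3) \<ge> d * (real k + 2) / 2
      \<and> c (k + 2) \<ge> d \<and> c (k + 3) \<ge> d" for k
  proof (induction k)
    case 0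
    then show ?case using d by (simp add: numeral_2_eq_2 numeral_3_eq_3)
  next
    case (Suc k)
    have "c (Suc (Suc (k + 2))) \<ge> c (Suc (k + 2)) + 2 * c (k + 2)"
      using Suc d by (intro growth) (auto simp: numeral_3_eq_3)
    then have step: "c (Suc k + 3) \<ge> c (k + 3) + 2 * c (k + 2)"
      by (simp add: numeral_2_eq_2 numeral_3_eq_3)
    have "c (Suc k + 2) = c (k + 3)"
      by (simp add: numeral_2_eq_2 numeral_3_eq_3)
    with Suc step d show ?case by (auto simp: field_simps)
  qed
  have "filterlim (\<lambda>k. d / 2 * (real k + 1)) at_top sequentially"
    using d by real_asymp
  then have "filterlim (\<lambda>k. c (k + 2)) at_top sequentially"
    by (rule filterlim_at_top_mono) (use bound in \<open>auto simp: field_simps\<close>)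
  then show ?thesis
    using filterlim_sequentially_Suc[of c at_top] filterlim_sequentially_Suc[of "\<lambda>n. c (Suc n)" at_top]
    by simp
qed

text \<open>By the recurrence assumed for \<open>h\<close>, \<open>(-1) ^ n * h n\<close> solves the
  three-term recurrence of the numerators and denominators, so agreement at \<open>n = 0\<close> and
  \<open>n = 1\<close> suffices.\<close>

lemma cf_num_minus_cf_den:
  assumes "h 1 = a 1 - h 0 * b 1"
    and "\<And>n. h (Suc (Suc n)) = a (Suc (Suc n)) * h n - b (Suc (Suc n)) * h (Suc n)"
  shows "cf_num a b n - h 0 * cf_den a b n = - ((-1) ^ n * h n)"
proof (induction n rule: induct_nat_012)
  case (ge2 n)
  have "cf_num a b (Suc (Suc n)) - h 0 * cf_den a b (Suc (Suc n))
      = b (Suc (Suc n)) * (cf_num a b (Suc n) - h 0 * cf_den a b (Suc n))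
        + a (Suc (Suc n)) * (cf_num a b n - h 0 * cf_den a b n)"
    by (simp add: algebra_simps)
  also have "\<dots> = - ((-1) ^ Suc (Suc n) * h (Suc (Suc n)))"
    unfolding ge2.IH assms(2) by (simp add: algebra_simps)
  finally show ?case .
qed (use assms(1) in auto)

text \<open>The convergents differ from \<open>h 0\<close> by \<open>(-1) ^ n / c n\<close> up to
  sign, with \<open>c n = B_n / h n\<close>. The bound \<open>dom\<close> starts at index 4, where
  \<open>B_2\<close> and \<open>B_3\<close> are the initial values of the growth.\<close>

lemma has_cf_value_alternating:
  fixes a b h :: "nat \<Rightarrow> real"
  assumes pos: "\<And>n. h n > 0"
    and h1: "h 1 = a 1 - h 0 * b 1"
    and rec: "\<And>n. h (Suc (Suc n)) = a (Suc (Suc n)) * h n - b (Suc (Suc n)) * h (Suc n)"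
    and B: "cf_den a b 2 > 0" "cf_den a b 3 > 0"
    and dom: "\<And>n. n \<ge> 2 \<Longrightarrow> h (Suc (Suc n)) \<le> b (Suc (Suc n)) * h (Suc n)"
  shows "has_cf_value a b (h 0)"
proof -
  define c where "c n = cf_den a b n / h n" for n
  have den: "cf_den a b n = c n * h n" for n
    using pos[of n] by (simp add: c_def)
  have lim: "filterlim c at_top sequentially"
  proof (rule filterlim_at_top_of_linear_growth)
    show "c 2 > 0" "c 3 > 0"
      using B pos by (simp_all add: c_def)
    fix n :: nat
    assume n: "n \<ge> 2" "c n \<ge> 0" "c (Suc n) \<ge> 0"
    define P where "P = b (Suc (Suc n)) * h (Suc n)"
    have "h (Suc (Suc n)) \<le> P"
      using dom[OF n(1)] by (simp add: P_def)
    have "c (Suc (Suc n)) * h (Suc (Suc n)) = P * c (Suc n) + a (Suc (Suc n)) * h n * c n"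
      unfolding den[symmetric] P_def by (simp add: den algebra_simps)
    also have "a (Suc (Suc n)) * h n = h (Suc (Suc n)) + P"
      using rec[of n] by (simp add: P_def)
    \<comment> \<open>Both occurrences of \<open>P\<close> are lowered to
      \<open>h (Suc (Suc n))\<close>, as \<open>c n\<close> and \<open>c (Suc n)\<close> are
      nonnegative; dividing by it leaves the coefficients 1 and 2.\<close>
    also have "P * c (Suc n) + (h (Suc (Suc n)) + P) * c n
        \<ge> h (Suc (Suc n)) * c (Suc n) + (h (Suc (Suc n)) + h (Suc (Suc n))) * c n"
      using n \<open>h (Suc (Suc n)) \<le> P\<close> by (intro add_mono mult_right_mono) auto
    finally have "(c (Suc n) + 2 * c n) * h (Suc (Suc n)) \<le> c (Suc (Suc n)) * h (Suc (Suc n))"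
      by (simp add: algebra_simps)
    then show "c (Suc (Suc n)) \<ge> c (Suc n) + 2 * c n"
      using pos[of "Suc (Suc n)"] by simp
  qed
  have ev: "\<forall>\<^sub>F n in sequentially. c n > 0"
    using lim by (simp add: filterlim_at_top_dense)
  have "\<forall>\<^sub>F n in sequentially. cf_den a b n \<noteq> 0"
    using ev by eventually_elim (use pos in \<open>simp add: den less_imp_neq[symmetric]\<close>)
  moreover have "(\<lambda>n. cf_num a b n / cf_den a b n) \<longlonglongrightarrow> h 0"
  proof -
    have "(\<lambda>n. inverse (c n)) \<longlonglongrightarrow> 0"
      using lim by (rule tendsto_inverse_0_at_top)
    then have "(\<lambda>n. (-1) ^ n * inverse (c n)) \<longlonglongrightarrow> 0"
      by (subst tendsto_rabs_zero_iff[symmetric], subst (asm) tendsto_rabs_zero_iff[symmetric])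
        (simp add: abs_mult power_abs)
    then have "(\<lambda>n. h 0 - (-1) ^ n * inverse (c n)) \<longlonglongrightarrow> h 0 - 0"
      by (intro tendsto_intros)
    moreover have "\<forall>\<^sub>F n in sequentially. h 0 - (-1) ^ n * inverse (c n) = cf_num a b n / cf_den a b n"
      using ev
    proof eventually_elim
      case (elim n)
      have "cf_num a b n = h 0 * cf_den a b n - (-1) ^ n * h n"
        using cf_num_minus_cf_den[of h a b n, OF h1 rec] by simp
      then have "cf_num a b n / cf_den a b n = h 0 - (-1) ^ n * h n / cf_den a b n"
        using elim pos[of n] by (simp add: den diff_divide_distrib less_imp_neq[symmetric])
      then show ?case
        using pos[of n] by (simp add: den divide_inverse)
    qed
    ultimately show ?thesis
      by (simp cong: filterlim_cong add: filterlim_cong[OF refl refl])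
  qed
  ultimately show ?thesis
    by (simp add: has_cf_value_def)
qed

section \<open>The cubic and its recurrence\<close>

text \<open>This is \<open>g\<close> in the shape in which the stated coefficients contain it. Its
  values 1 at \<open>x = 1\<close> and \<open>6 * m + 1\<close> at \<open>x = 2\<close> are the two
  limits.\<close>

definition cubic :: "real \<Rightarrow> real \<Rightarrow> real" where
  "cubic m x = (x\<^sup>2 - 1) * x * m + 1"

lemma cubic_ge_1:
  assumes "m \<ge> 0" "x \<ge> 1"
  shows "cubic m x \<ge> 1"
proof -
  have "x\<^sup>2 \<ge> 1" using assms by simp
  then show ?thesis using assms by (simp add: cubic_def)
qed

lemma cubic_Suc_le:
  assumes "m \<ge> 0" "x \<ge> 3"
  shows "cubic m (x + 1) \<le> 3 * cubic m x"
proof -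
  have "3 * cubic m x - cubic m (x + 1) = m * (x * (x + 1) * (2 * x - 5)) + 2"
    by (simp add: cubic_def algebra_simps power2_eq_square)
  moreover have "m * (x * (x + 1) * (2 * x - 5)) \<ge> 0"
    using assms by simp
  ultimately show ?thesis by linarith
qed

text \<open>One identity serves both parts: \<open>x = n\<close> in (i) and \<open>x = n + 1\<close>
  in (ii).\<close>

lemma cubic_recurrence:
  "cubic m (x + 1) =
     (F * cubic m x + 2 * m * x * (x + 1) - 1) * cubic m (x - 1)
     - (F * cubic m (x - 1) + 2 * m * x * (x - 2) - 2) * cubic m x"
  unfolding cubic_def by algebra

text \<open>The partial denominator is at least \<open>1 + 6 - 2\<close>, which exceeds the factor 3
  by which \<open>cubic\<close> can grow in one step.\<close>

lemma cubic_le_partial_denominator: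
  assumes m: "m \<ge> 1" and x: "x \<ge> 3" and F: "F \<ge> 1"
  shows "cubic m (x + 1) \<le> (F * cubic m (x - 1) + 2 * m * x * (x - 2) - 2) * cubic m x"
proof -
  have "1 * 1 \<le> F * cubic m (x - 1)"
    using assms cubic_ge_1[of m "x - 1"] by (intro mult_mono) auto
  moreover have "1 * 3 * 1 \<le> m * x * (x - 2)"
    using assms by (intro mult_mono) auto
  ultimately have "3 \<le> F * cubic m (x - 1) + 2 * m * x * (x - 2) - 2"
    by simp
  then have "3 * cubic m x \<le> (F * cubic m (x - 1) + 2 * m * x * (x - 2) - 2) * cubic m x"
    using assms cubic_ge_1[of m x] by (intro mult_right_mono) auto
  with cubic_Suc_le[of m x] assms show ?thesis by linarith
qed

section \<open>The two continued fractions for arbitrary values \<open>F n\<close>\<close>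

lemma has_cf_value_cubic_1:
  fixes F :: "nat \<Rightarrow> real" and m :: real
  assumes F: "\<And>n. n \<ge> 1 \<Longrightarrow> F n \<ge> 1" and F2: "F 2 > 2" and m: "m \<ge> 1"
  shows "has_cf_value
    (\<lambda>n. F n * cubic m (real n) + 2 * m * real n * (real n + 1) - 1)
    (\<lambda>n. F n * cubic m (real n - 1) + 2 * m * real n * (real n - 2) - 2) 1"
    (is "has_cf_value ?a ?b 1")
proof -
  have den2: "cf_den ?a ?b 2 \<ge> 24 * m + 1"
  proof -
    \<comment> \<open>Here \<open>b_2 = F 2 - 2\<close> and \<open>B_1 = F 1 - 2 * m - 2\<close>,
      which may be negative. Expanding around \<open>F 1 = 1\<close>, \<open>F 2 = 2\<close> leaves
      nonnegative products and a positive constant.\<close>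
    have "cf_den ?a ?b 2 = (F 2 - 2) * (F 1 - 1) + 4 * m * (F 2 - 2) + 24 * m + 1"
      by (simp add: numeral_2_eq_2 cubic_def algebra_simps power2_eq_square)
    moreover have "(F 2 - 2) * (F 1 - 1) \<ge> 0" "4 * m * (F 2 - 2) \<ge> 0"
      using F[of 1] F2 m by simp_all
    ultimately show ?thesis by linarith
  qed
  have den3: "cf_den ?a ?b 3 > 0"
  proof -
    have b3: "?b 3 = F 3 * (6 * m + 1) + 6 * m - 2" and a3: "?a 3 = F 3 * (24 * m + 1) + 24 * m - 1"
      by (simp_all add: cubic_def algebra_simps)
    have F3: "F 3 \<ge> 1" using F by simp
    have "cf_den ?a ?b 3 = ?b 3 * cf_den ?a ?b 2 + ?a 3 * cf_den ?a ?b 1"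
      by (simp add: numeral_2_eq_2 numeral_3_eq_3)
    moreover have "6 * m + 1 \<le> F 3 * (6 * m + 1)" "24 * m + 1 \<le> F 3 * (24 * m + 1)"
      using F3 m by simp_all
    then have "?b 3 \<ge> 0" and "?a 3 \<ge> 0"
      unfolding a3 b3 using m by - linarith+
    have "cf_den ?a ?b 1 \<ge> - (2 * m + 1)"
      using F[of 1] by (simp add: cubic_def)
    then have "?a 3 * cf_den ?a ?b 1 \<ge> ?a 3 * (- (2 * m + 1))"
      using \<open>?a 3 \<ge> 0\<close> by (rule mult_left_mono)
    moreover have "?b 3 * cf_den ?a ?b 2 \<ge> ?b 3 * (24 * m + 1)"
      using den2 \<open>?b 3 \<ge> 0\<close> by (rule mult_left_mono)
    \<comment> \<open>Expanding around \<open>F 3 = 1\<close> and splitting \<open>m * m\<close> as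
      \<open>m * (m - 1) + m\<close> makes the sign visible for \<open>m \<ge> 1\<close>.\<close>
    moreover have "?b 3 * (24 * m + 1) + ?a 3 * (- (2 * m + 1))
        = (F 3 - 1) * (4 * m * (24 * m + 1)) + 192 * (m * (m - 1)) + 132 * m - 1"
      unfolding a3 b3 by (simp add: algebra_simps)
    moreover have "(F 3 - 1) * (4 * m * (24 * m + 1)) \<ge> 0" "m * (m - 1) \<ge> 0"
      using F3 m by simp_all
    ultimately show ?thesis using m by linarith
  qed
  have "has_cf_value ?a ?b (cubic m (real 0 + 1))"
  proof (rule has_cf_value_alternating[where h = "\<lambda>n. cubic m (real n + 1)"])
    show "cubic m (real n + 1) > 0" for n
      using cubic_ge_1[of m "real n + 1"] m by simp
    show "cubic m (real 1 + 1) = ?a 1 - cubic m (real 0 + 1) * ?b 1"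
      by (simp add: cubic_def algebra_simps)
    show "cubic m (real (Suc (Suc n)) + 1)
        = ?a (Suc (Suc n)) * cubic m (real n + 1) - ?b (Suc (Suc n)) * cubic m (real (Suc n) + 1)" for n
      using cubic_recurrence[of m "real n + 2" "F (Suc (Suc n))"] by (simp add: algebra_simps)
    show "cf_den ?a ?b 2 > 0" using den2 m by linarith
    show "cf_den ?a ?b 3 > 0" by (rule den3)
    show "cubic m (real (Suc (Suc n)) + 1) \<le> ?b (Suc (Suc n)) * cubic m (real (Suc n) + 1)"
      if "n \<ge> 2" for n
      using cubic_le_partial_denominator[of m "real n + 2" "F (Suc (Suc n))"] that F[of "Suc (Suc n)"] m
      by (simp add: algebra_simps)
  qed
  then show ?thesis by (simp add: cubic_def)
qed

lemma has_cf_value_cubic_2: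
  fixes F :: "nat \<Rightarrow> real" and m :: real
  assumes F: "\<And>n. n \<ge> 1 \<Longrightarrow> F n \<ge> 1" and m: "m \<ge> 1"
  shows "has_cf_value
    (\<lambda>n. F n * cubic m (real n + 1) + 2 * m * (real n + 1) * (real n + 2) - 1)
    (\<lambda>n. F n * cubic m (real n) + 2 * m * (real n + 1) * (real n - 1) - 2) (6 * m + 1)"
    (is "has_cf_value ?a ?b _")
proof -
  have den2: "cf_den ?a ?b 2 \<ge> 36 * m + 1"
  proof -
    have b2: "?b 2 = F 2 * (6 * m + 1) + 6 * m - 2"
      by (simp add: cubic_def algebra_simps)
    have "6 * m + 1 \<le> F 2 * (6 * m + 1)"
      using F[of 2] m by simp
    then have "?b 2 \<ge> 0"
      unfolding b2 using m by linarith
    then have "?b 2 * (F 1 - 1) \<ge> 0"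
      using F[of 1] by (intro mult_nonneg_nonneg) auto
    \<comment> \<open>Since \<open>B_1 = (F 1 - 1) - 1\<close>, the terms after the first are
      \<open>a_2 - b_2\<close>, expanded around \<open>F 2 = 1\<close>.\<close>
    moreover have "cf_den ?a ?b 2 = ?b 2 * (F 1 - 1) + 18 * (m * (F 2 - 1)) + 36 * m + 1"
      by (simp add: numeral_2_eq_2 cubic_def algebra_simps power2_eq_square)
    moreover have "m * (F 2 - 1) \<ge> 0"
      using F[of 2] m by simp
    ultimately show ?thesis by linarith
  qed
  have den3: "cf_den ?a ?b 3 > 0"
  proof -
    have b3: "?b 3 = F 3 * (24 * m + 1) + 16 * m - 2" and a3: "?a 3 = F 3 * (60 * m + 1) + 40 * m - 1"
      by (simp_all add: cubic_def algebra_simps)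
    have F3: "F 3 \<ge> 1" using F by simp
    have "cf_den ?a ?b 3 = ?b 3 * cf_den ?a ?b 2 + ?a 3 * cf_den ?a ?b 1"
      by (simp add: numeral_2_eq_2 numeral_3_eq_3)
    moreover have "24 * m + 1 \<le> F 3 * (24 * m + 1)" "60 * m + 1 \<le> F 3 * (60 * m + 1)"
      using F3 m by simp_all
    then have "?b 3 \<ge> 0" and "?a 3 \<ge> 0"
      unfolding a3 b3 using m by - linarith+
    have "cf_den ?a ?b 1 \<ge> - 1"
      using F[of 1] by (simp add: cubic_def)
    then have "?a 3 * cf_den ?a ?b 1 \<ge> ?a 3 * (- 1)"
      using \<open>?a 3 \<ge> 0\<close> by (rule mult_left_mono)
    moreover have "?b 3 * cf_den ?a ?b 2 \<ge> ?b 3 * (36 * m + 1)"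
      using den2 \<open>?b 3 \<ge> 0\<close> by (rule mult_left_mono)
    moreover have "?b 3 * (36 * m + 1) + ?a 3 * (- 1)
        = (F 3 - 1) * (864 * (m * m)) + 1440 * (m * (m - 1)) + 1344 * m - 1"
      unfolding a3 b3 by (simp add: algebra_simps)
    moreover have "(F 3 - 1) * (864 * (m * m)) \<ge> 0" "m * (m - 1) \<ge> 0"
      using F3 m by simp_all
    ultimately show ?thesis using m by linarith
  qed
  have "has_cf_value ?a ?b (cubic m (real 0 + 2))"
  proof (rule has_cf_value_alternating[where h = "\<lambda>n. cubic m (real n + 2)"])
    show "cubic m (real n + 2) > 0" for n
      using cubic_ge_1[of m "real n + 2"] m by simp
    show "cubic m (real 1 + 2) = ?a 1 - cubic m (real 0 + 2) * ?b 1"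
      by (simp add: cubic_def algebra_simps)
    show "cubic m (real (Suc (Suc n)) + 2)
        = ?a (Suc (Suc n)) * cubic m (real n + 2) - ?b (Suc (Suc n)) * cubic m (real (Suc n) + 2)" for n
      using cubic_recurrence[of m "real n + 3" "F (Suc (Suc n))"] by (simp add: algebra_simps)
    show "cf_den ?a ?b 2 > 0" using den2 m by linarith
    show "cf_den ?a ?b 3 > 0" by (rule den3)
    show "cubic m (real (Suc (Suc n)) + 2) \<le> ?b (Suc (Suc n)) * cubic m (real (Suc n) + 2)"
      if "n \<ge> 2" for n
      using cubic_le_partial_denominator[of m "real n + 3" "F (Suc (Suc n))"] that F[of "Suc (Suc n)"] m
      by (simp add: algebra_simps)
  qed
  then show ?thesis by (simp add: cubic_def algebra_simps)
qed

section \<open>Matching the stated coefficients with the cubic\<close>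

theorem corollary6:
  fixes f :: "real poly" and m :: nat
  assumes "\<And>n::nat. n \<ge> 1 \<Longrightarrow> poly f (real n) \<ge> 1"
    and "m \<ge> 1"
  shows "(poly f 2 > 2 \<longrightarrow>
      has_cf_value
        (\<lambda>n. poly f (real n) * (((real n)^2 - 1) * real n * real m + 1)
               + 2 * real m * real n * (real n + 1) - 1)
        (\<lambda>n. poly f (real n) * (((real n)^2 - 3 * real n + 2) * real m * real n + 1)
               + 2 * real m * real n * (real n - 2) - 2)
        1)
    \<and> has_cf_value
        (\<lambda>n. poly f (real n) * (((real n)^2 + 3 * real n + 2) * real n * real m + 1)
               + 2 * real m * (real n)^2 + 6 * real m * real n + 4 * real m - 1)
        (\<lambda>n. poly f (real n) * (((real n)^2 - 1) * real n * real m + 1)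
               + 2 * ((real n)^2 - 1) * real m - 2)
        (6 * real m + 1)"
proof (intro conjI impI)
  have m: "real m \<ge> 1" using assms(2) by simp
  show "has_cf_value
        (\<lambda>n. poly f (real n) * (((real n)^2 - 1) * real n * real m + 1)
               + 2 * real m * real n * (real n + 1) - 1)
        (\<lambda>n. poly f (real n) * (((real n)^2 - 3 * real n + 2) * real m * real n + 1)
               + 2 * real m * real n * (real n - 2) - 2)
        1" if "poly f 2 > 2"
  proof -
    \<comment> \<open>The quadratic is \<open>(n - 1) * (n - 2)\<close>, so its product with
      \<open>n\<close> is \<open>x^3 - x\<close> at \<open>x = n - 1\<close>.\<close>
    have "((real n)^2 - 3 * real n + 2) * real m * real n + 1 = cubic (real m) (real n - 1)" for n
      by (simp add: cubic_def algebra_simps power2_eq_square)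
    then show ?thesis
      using has_cf_value_cubic_1[of "\<lambda>n. poly f (real n)" "real m"] assms(1) that m
      by (simp only: cubic_def[of "real m" "real n" for n, symmetric]) simp
  qed
  \<comment> \<open>The second equation carries an arbitrary leading summand \<open>F\<close>
    because sums nest to the left and the remaining terms alone form no subterm.\<close>
  have "((real n)^2 + 3 * real n + 2) * real n * real m + 1 = cubic (real m) (real n + 1)"
    "F + 2 * real m * (real n)^2 + 6 * real m * real n + 4 * real m - 1
      = F + 2 * real m * (real n + 1) * (real n + 2) - 1"
    "2 * ((real n)^2 - 1) * real m = 2 * real m * (real n + 1) * (real n - 1)" for n F
    by (simp_all add: cubic_def algebra_simps power2_eq_square)
  then show "has_cf_value
        (\<lambda>n. poly f (real n) * (((real n)^2 + 3 * real n + 2) * real n * real m + 1)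
               + 2 * real m * (real n)^2 + 6 * real m * real n + 4 * real m - 1)
        (\<lambda>n. poly f (real n) * (((real n)^2 - 1) * real n * real m + 1)
               + 2 * ((real n)^2 - 1) * real m - 2)
        (6 * real m + 1)"
    using has_cf_value_cubic_2[of "\<lambda>n. poly f (real n)" "real m"] assms(1) m
    by (simp only: cubic_def[of "real m" "real n" for n, symmetric])
qed

end
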